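(* Let $m\geq 2$ and $n\geq 3$ be integers with $m\leq n$, and let $m_0=\max\{k\in\mathbb{N} : k(k-1)-1\leq n\}$. (a) If $m\leq m_0-1$, then $\chi_L(K_m\square K_n)=n+1$. (b) If $m_0+1\leq m\leq \frac{n}{2}$, then $\chi_L(K_m\square K_n)=n+2$.
   Context: $K_k$ is the complete graph on $k$ vertices and $\square$ the cartesian product: $V(G\square H)=V(G)\times V(H)$, with $(a,b)\sim(a',b')$ iff ($a=a'$ and $bb'\in E(H)$) or ($aa'\in E(G)$ and $b=b'$). For a connected graph $G$, with $d$ the shortest-path distance and $d(v,S)=\min_{x\in S}d(v,x)$, a proper $k$-coloring (onto $\{1,\dots,k\}$) with ordered color classes $(V_1,\dots,V_k)$ is a locating coloring if distinct vertices $v$ have distinct color codes $(d(v,V_1),\dots,d(v,V_k))$; $\chi_L(G)$ is the minimum $k$ for which a locating $k$-coloring exists. *)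

theory Defs
  imports "Graph_Theory.Graph_Theory" "Graph_Theory.Kuratowski"
begin

text \<open>
  Simple undirected graphs are finite symmetric loop-free pair digraphs (locale \<^locale>\<open>pair_graph\<close>);
  an edge \<open>uv\<close> is represented by the two arcs \<open>(u, v)\<close> and \<open>(v, u)\<close>.
\<close>

definition cart_prod :: "'a pair_pre_digraph \<Rightarrow> 'b pair_pre_digraph \<Rightarrow> ('a \<times> 'b) pair_pre_digraph"
    (infixl "\<box>" 70) where
  "G \<box> H = \<lparr> pverts = pverts G \<times> pverts H,
     parcs = {((a, b), (a', b')).
       (a \<in> pverts G \<and> a = a' \<and> (b, b') \<in> parcs H) \<or>
       ((a, a') \<in> parcs G \<and> b \<in> pverts H \<and> b = b')} \<rparr>"

lemma pair_graph_cart_prod: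
  assumes "pair_graph G" "pair_graph H"
  shows "pair_graph (G \<box> H)"
proof -
  interpret G: pair_graph G by fact
  interpret H: pair_graph H by fact
  show ?thesis
  proof
    have "parcs (G \<box> H) \<subseteq> (pverts G \<times> pverts H) \<times> (pverts G \<times> pverts H)"
      by (auto simp: cart_prod_def dest: G.arc_fst_in_verts G.arc_snd_in_verts
            H.arc_fst_in_verts H.arc_snd_in_verts)
    then show "finite (parcs (G \<box> H))"
      by (rule finite_subset) simp
    show "finite (pverts (G \<box> H))"
      by (simp add: cart_prod_def)
    show "symmetric (with_proj (G \<box> H))"
      unfolding symmetric_def
      by (rule symI) (auto simp: cart_prod_def arcs_ends_conv
          dest: G.arcs_symmetric H.arcs_symmetric)
  qed (auto simp: cart_prod_def dest: G.arc_fst_in_verts G.arc_snd_in_verts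
            H.arc_fst_in_verts H.arc_snd_in_verts G.no_loops' H.no_loops')
qed

definition graph_dist :: "'a pair_pre_digraph \<Rightarrow> 'a \<Rightarrow> 'a \<Rightarrow> ereal" where
  "graph_dist G u v = wf_digraph.\<mu> (with_proj G) (\<lambda>_. 1) u v"

text \<open>The infimum is attained for nonempty \<open>S\<close>, since all distances are in \<open>\<nat> \<union> {\<infinity>}\<close>.\<close>

definition set_dist :: "'a pair_pre_digraph \<Rightarrow> 'a \<Rightarrow> 'a set \<Rightarrow> ereal" where
  "set_dist G v S = (INF x\<in>S. graph_dist G v x)"

definition color_class :: "'a pair_pre_digraph \<Rightarrow> ('a \<Rightarrow> nat) \<Rightarrow> nat \<Rightarrow> 'a set" where
  "color_class G c i = {v \<in> pverts G. c v = i}"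

definition color_code :: "'a pair_pre_digraph \<Rightarrow> nat \<Rightarrow> ('a \<Rightarrow> nat) \<Rightarrow> 'a \<Rightarrow> ereal list" where
  "color_code G k c v = map (\<lambda>i. set_dist G v (color_class G c i)) [1..<Suc k]"

definition proper_coloring :: "'a pair_pre_digraph \<Rightarrow> nat \<Rightarrow> ('a \<Rightarrow> nat) \<Rightarrow> bool" where
  "proper_coloring G k c \<longleftrightarrow>
     c ` pverts G = {1..k} \<and> (\<forall>(u, v) \<in> parcs G. c u \<noteq> c v)"

definition locating_coloring :: "'a pair_pre_digraph \<Rightarrow> nat \<Rightarrow> ('a \<Rightarrow> nat) \<Rightarrow> bool" where
  "locating_coloring G k c \<longleftrightarrow>
     proper_coloring G k c \<and> inj_on (color_code G k c) (pverts G)"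

text \<open>
  For a finite simple graph the minimum is over a nonempty set: giving every vertex its own
  color is a locating coloring, as 0 occurs in the code of \<open>v\<close> only at the color of \<open>v\<close>.
\<close>

definition locating_chromatic_number :: "'a pair_pre_digraph \<Rightarrow> nat" ("\<chi>\<^sub>L") where
  "\<chi>\<^sub>L G = (LEAST k. \<exists>c. locating_coloring G k c)"

end

theory Submission
  imports Defs "HOL-Number_Theory.Cong"
begin

text \<open>
  The product has diameter 2, so a proper coloring is locating iff two cells of the same color are
  separated by the set of colors in the cross formed by their row and column.

  With \<open>n\<close> colors every cross is full. With \<open>n + 1\<close> colors each row \<open>a\<close> omits one color \<open>r a\<close>, and the
  cells with a full cross have pairwise different colors. If \<open>2 * m \<le> n\<close>, then \<open>r\<close> is injective,
  so there are \<open>m * (m - 1)\<close> such cells and \<open>m * (m - 1) \<le> n + 1\<close>. Conversely, for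
  \<open>m * (m + 1) \<le> n + 1\<close> one prescribes, in an \<open>m \<times> (n + 1)\<close> Latin rectangle, different colors for
  the cells that will have a full cross, completes the rectangle row by row and deletes a
  column. With \<open>n + 2\<close> colors and \<open>2 * m \<le> n + 2\<close>, shifting each row by two positions works.
\<close>

section \<open>Color codes in graphs of diameter at most 2\<close>

lemma graph_dist_diameter_2:
  assumes "pair_graph G" and "u \<in> pverts G" and "v \<in> pverts G"
    and diam: "u \<noteq> v \<Longrightarrow> (u, v) \<notin> parcs G \<Longrightarrow> \<exists>w. (u, w) \<in> parcs G \<and> (w, v) \<in> parcs G"
  shows "graph_dist G u v = (if u = v then 0 else if (u, v) \<in> parcs G then 1 else 2)"
proof -
  interpret pair_graph G by fact
  have cost: "awalk_cost (\<lambda>_. 1) p = length p" for p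
    by (induction p) auto
  have \<mu>: "graph_dist G u v = (INF p\<in>{p. awalk u p v}. ereal (length p))"
    by (simp add: graph_dist_def \<mu>_def cost)
  have le: "graph_dist G u v \<le> ereal (length p)" if "awalk u p v" for p
    using that unfolding \<mu> by (auto intro: INF_lower2)
  have ge: "ereal l \<le> graph_dist G u v" if "\<And>p. awalk u p v \<Longrightarrow> l \<le> length p" for l
    using that unfolding \<mu> by (auto intro!: INF_greatest)
  consider "u = v" | "u \<noteq> v" "(u, v) \<in> parcs G" | "u \<noteq> v" "(u, v) \<notin> parcs G" by blast
  then show ?thesis
  proof cases
    case 1
    then show ?thesis
      using le[of "[]"] ge[of 0] assms by (auto simp: awalk_Nil_iff zero_ereal_def intro: antisym)
  next
    case 2
    have "awalk u [(u, v)] v" using 2 assms by (auto simp: awalk_Cons_iff awalk_Nil_iff)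
    moreover have "1 \<le> length p" if "awalk u p v" for p
      using that 2 by (cases p) (auto simp: awalk_Nil_iff)
    ultimately show ?thesis
      using le[of "[(u, v)]"] ge[of 1] 2 by (auto simp: one_ereal_def intro: antisym)
  next
    case 3
    then obtain w where w: "(u, w) \<in> parcs G" "(w, v) \<in> parcs G" using diam by blast
    have "awalk u [(u, w), (w, v)] v"
      using w assms by (auto simp: awalk_Cons_iff awalk_Nil_iff)
    moreover have "2 \<le> length p" if "awalk u p v" for p
      using that 3 by (cases p; cases "tl p") (auto simp: awalk_Nil_iff awalk_Cons_iff)
    ultimately show ?thesis
      using le[of "[(u, w), (w, v)]"] ge[of 2] 3 by (auto simp: intro: antisym)
  qed
qed

lemma set_dist_diameter_2:
  assumes "pair_graph G" and "u \<in> pverts G" and "S \<subseteq> pverts G" and "S \<noteq> {}"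
    and diam: "\<And>v. v \<in> pverts G \<Longrightarrow> u \<noteq> v \<Longrightarrow> (u, v) \<notin> parcs G \<Longrightarrow>
      \<exists>w. (u, w) \<in> parcs G \<and> (w, v) \<in> parcs G"
  shows "set_dist G u S = (if u \<in> S then 0 else if \<exists>v\<in>S. (u, v) \<in> parcs G then 1 else 2)"
proof -
  have gd: "graph_dist G u v = (if u = v then 0 else if (u, v) \<in> parcs G then 1 else 2)" if "v \<in> S" for v
    using that assms by (intro graph_dist_diameter_2) auto
  obtain s where s: "s \<in> S" using assms(4) by blast
  show ?thesis
    unfolding set_dist_def
  proof (rule INF_eqI)
    show "(if u \<in> S then 0 else if \<exists>v\<in>S. (u, v) \<in> parcs G then 1 else 2) \<le> graph_dist G u v"
      if "v \<in> S" for v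
      using that gd[OF that] by (auto simp: one_ereal_def)
    show "y \<le> (if u \<in> S then 0 else if \<exists>v\<in>S. (u, v) \<in> parcs G then 1 else 2)"
      if y: "\<And>v. v \<in> S \<Longrightarrow> y \<le> graph_dist G u v" for y
      using y[OF s] y gd s by (smt (verit, best))
  qed
qed

text \<open>All distances are 0, 1 or 2. In the code of a vertex the entry 0 marks its own color, 1
  marks the colors of its neighbors and 2 all others, so the code carries the same information as
  the own color together with the set of neighboring colors.\<close>

lemma locating_coloring_diameter_2_iff:
  assumes G: "pair_graph G"
    and diam: "\<And>u v. u \<in> pverts G \<Longrightarrow> v \<in> pverts G \<Longrightarrow> u \<noteq> v \<Longrightarrow> (u, v) \<notin> parcs G \<Longrightarrow>
      \<exists>w. (u, w) \<in> parcs G \<and> (w, v) \<in> parcs G"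
  shows "locating_coloring G k c \<longleftrightarrow> proper_coloring G k c \<and>
    (\<forall>u\<in>pverts G. \<forall>v\<in>pverts G. c u = c v \<and> c ` (parcs G `` {u}) = c ` (parcs G `` {v}) \<longrightarrow> u = v)"
proof -
  interpret pair_graph G by fact
  have "color_code G k c u = color_code G k c v \<longleftrightarrow>
      c u = c v \<and> c ` (parcs G `` {u}) = c ` (parcs G `` {v})"
    if c: "proper_coloring G k c" and uv: "u \<in> pverts G" "v \<in> pverts G" for u v
  proof -
    have im: "c ` pverts G = {1..k}"
      and proper: "\<And>x y. (x, y) \<in> parcs G \<Longrightarrow> c x \<noteq> c y"
      using c by (auto simp: proper_coloring_def)
    let ?d = "\<lambda>x i. if c x = i then 0 else if i \<in> c ` (parcs G `` {x}) then 1 else (2::ereal)"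
    have sd: "set_dist G x (color_class G c i) = ?d x i"
      if "x \<in> pverts G" "i \<in> {1..k}" for x i
    proof -
      have "color_class G c i \<noteq> {}" "color_class G c i \<subseteq> pverts G"
        using that(2) unfolding im[symmetric] by (auto simp: color_class_def)
      then have "set_dist G x (color_class G c i) =
        (if x \<in> color_class G c i then 0
         else if \<exists>v\<in>color_class G c i. (x, v) \<in> parcs G then 1 else 2)"
        using that diam G by (intro set_dist_diameter_2) auto
      then show ?thesis
        using that by (auto simp: color_class_def dest: in_arcsD2)
    qed
    have nb: "c ` (parcs G `` {x}) \<subseteq> {1..k} - {c x}" if "x \<in> pverts G" for x
    proof
      fix i assume "i \<in> c ` (parcs G `` {x})"
      then obtain y where "(x, y) \<in> parcs G" "i = c y" by blast
      then show "i \<in> {1..k} - {c x}"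
        using proper[of x y] in_arcsD2[of x y] unfolding im[symmetric] by auto
    qed
    have upt: "set [1..<Suc k] = {1..k}" by auto
    have "color_code G k c u = color_code G k c v \<longleftrightarrow>
        (\<forall>i\<in>{1..k}. set_dist G u (color_class G c i) = set_dist G v (color_class G c i))"
      unfolding color_code_def map_eq_conv upt ..
    also have "\<dots> \<longleftrightarrow> (\<forall>i\<in>{1..k}. ?d u i = ?d v i)"
      by (intro ball_cong refl) (simp only: sd[OF uv(1)] sd[OF uv(2)])
    also have "\<dots> \<longleftrightarrow> c u = c v \<and> c ` (parcs G `` {u}) = c ` (parcs G `` {v})" (is "?l \<longleftrightarrow> ?r")
    proof
      assume l: ?l
      \<comment> \<open>The code of \<open>u\<close> vanishes at \<open>c u\<close>, and the code of
        \<open>v\<close> vanishes only at \<open>c v\<close>.\<close>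
      have "c u \<in> {1..k}" using im uv by blast
      with l have "?d u (c u) = ?d v (c u)" by (rule bspec)
      then have "c u = c v" by (simp split: if_splits)
      moreover have "i \<in> c ` (parcs G `` {u}) \<longleftrightarrow> i \<in> c ` (parcs G `` {v})" for i
      proof (cases "i \<in> {1..k} - {c u}")
        case True
        then have "?d u i = ?d v i" using l by blast
        then show ?thesis using True \<open>c u = c v\<close> by (simp split: if_splits)
      next
        case False
        then show ?thesis using nb[OF uv(1)] nb[OF uv(2)] \<open>c u = c v\<close> by auto
      qed
      ultimately show ?r by blast
    qed auto
    finally show ?thesis .
  qed
  then show ?thesis
    unfolding locating_coloring_def inj_on_def by (metis (no_types, lifting))
qed

section \<open>Colorings of a product of complete graphs as arrays\<close>

text \<open>The colors in the cross of row \<open>a\<close> and column \<open>b\<close>. The cell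
  itself is included, which makes the set a plain union of a row and a column.\<close>

definition seen :: "'a set \<Rightarrow> 'b set \<Rightarrow> ('a \<Rightarrow> 'b \<Rightarrow> 'c) \<Rightarrow> 'a \<Rightarrow> 'b \<Rightarrow> 'c set" where
  "seen A B f a b = f a ` B \<union> (\<lambda>x. f x b) ` A"

text \<open>Rows, columns and colors come from arbitrary sets, so that explicit arrays can be built
  on convenient intervals of numbers and transported afterwards.\<close>

definition locating_array :: "'a set \<Rightarrow> 'b set \<Rightarrow> 'c set \<Rightarrow> ('a \<Rightarrow> 'b \<Rightarrow> 'c) \<Rightarrow> bool" where
  "locating_array A B K f \<longleftrightarrow>
     (\<forall>a\<in>A. inj_on (f a) B) \<and> (\<forall>b\<in>B. inj_on (\<lambda>a. f a b) A) \<and> (\<Union>a\<in>A. f a ` B) = K \<and>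
     (\<forall>a\<in>A. \<forall>b\<in>B. \<forall>a'\<in>A. \<forall>b'\<in>B.
        f a b = f a' b' \<and> seen A B f a b = seen A B f a' b' \<longrightarrow> a = a' \<and> b = b')"

text \<open>Cells are adjacent iff they differ in exactly one coordinate, and two cells that differ
  in both have a common neighbor at a corner of their rectangle. The neighbors of a cell show the
  colors of its cross except its own; for cells of equal color, putting this color back turns
  equality of neighboring colors into equality of \<open>seen\<close>.\<close>

lemma locating_coloring_complete_product_iff:
  assumes "K\<^bsub>m\<^esub> (with_proj G)" and "K\<^bsub>n\<^esub> (with_proj H)"
  shows "locating_coloring (G \<box> H) k c \<longleftrightarrow>
    locating_array (pverts G) (pverts H) {1..k} (\<lambda>a b. c (a, b))"
proof -
  have verts: "pverts (G \<box> H) = pverts G \<times> pverts H" by (simp add: cart_prod_def)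
  have arcs: "((a, b), (a', b')) \<in> parcs (G \<box> H) \<longleftrightarrow>
      a \<in> pverts G \<and> a' \<in> pverts G \<and> b \<in> pverts H \<and> b' \<in> pverts H \<and> (a = a' \<longleftrightarrow> b \<noteq> b')" for a b a' b'
    using assms by (auto simp: cart_prod_def complete_digraph_pair_def)
  have proper: "proper_coloring (G \<box> H) k c \<longleftrightarrow>
      (\<forall>a\<in>pverts G. inj_on (\<lambda>b. c (a, b)) (pverts H)) \<and>
      (\<forall>b\<in>pverts H. inj_on (\<lambda>a. c (a, b)) (pverts G)) \<and>
      (\<Union>a\<in>pverts G. (\<lambda>b. c (a, b)) ` pverts H) = {1..k}"
  proof -
    have "(\<Union>a\<in>pverts G. (\<lambda>b. c (a, b)) ` pverts H) = c ` pverts (G \<box> H)"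
      unfolding verts by force
    moreover have "(\<forall>(u, v)\<in>parcs (G \<box> H). c u \<noteq> c v) \<longleftrightarrow>
      (\<forall>a\<in>pverts G. inj_on (\<lambda>b. c (a, b)) (pverts H)) \<and>
      (\<forall>b\<in>pverts H. inj_on (\<lambda>a. c (a, b)) (pverts G))"
      (is "?l \<longleftrightarrow> ?r")
    proof
      assume l: ?l
      have "c (a, b) \<noteq> c (a', b')"
        if "((a, b), (a', b')) \<in> parcs (G \<box> H)" for a b a' b'
        using l that by blast
      then have "c (a, b) \<noteq> c (a', b')"
        if "a \<in> pverts G" "a' \<in> pverts G" "b \<in> pverts H" "b' \<in> pverts H" "a = a' \<longleftrightarrow> b \<noteq> b'"
        for a b a' b'
        using that arcs by blast
      then show ?r
        unfolding inj_on_def by metis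
    next
      assume r: ?r
      have "c (a, b) \<noteq> c (a', b')"
        if "((a, b), (a', b')) \<in> parcs (G \<box> H)" for a b a' b'
        using r that unfolding arcs inj_on_def by metis
      then show ?l by auto
    qed
    ultimately show ?thesis unfolding proper_coloring_def by auto
  qed
  let ?seen = "seen (pverts G) (pverts H) (\<lambda>a b. c (a, b))"
  have nb: "c ` (parcs (G \<box> H) `` {(a, b)}) = ?seen a b - {c (a, b)}"
    if "proper_coloring (G \<box> H) k c" "a \<in> pverts G" "b \<in> pverts H" for a b
  proof -
    have ne: "c v \<noteq> c (a, b)" if "v \<in> parcs (G \<box> H) `` {(a, b)}" for v
      using \<open>proper_coloring (G \<box> H) k c\<close> that by (force simp: proper_coloring_def)
    have nbh: "parcs (G \<box> H) `` {(a, b)} =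
        ({a} \<times> pverts H \<union> pverts G \<times> {b}) - {(a, b)}"
      using that(2,3) by (auto simp: arcs)
    have seen: "?seen a b = c ` ({a} \<times> pverts H \<union> pverts G \<times> {b})"
      by (force simp: seen_def)
    show ?thesis
      using ne unfolding seen nbh by auto
  qed
  have own: "c (a, b) \<in> ?seen a b" if "a \<in> pverts G" "b \<in> pverts H" for a b
    using that by (auto simp: seen_def)
  have "pair_graph (G \<box> H)"
    using assms by (intro pair_graph_cart_prod pair_graphI_complete)
  then have "locating_coloring (G \<box> H) k c \<longleftrightarrow> proper_coloring (G \<box> H) k c \<and>
    (\<forall>u\<in>pverts (G \<box> H). \<forall>v\<in>pverts (G \<box> H).
      c u = c v \<and> c ` (parcs (G \<box> H) `` {u}) = c ` (parcs (G \<box> H) `` {v}) \<longrightarrow> u = v)"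
  proof (rule locating_coloring_diameter_2_iff)
    show "\<exists>w. (u, w) \<in> parcs (G \<box> H) \<and> (w, v) \<in> parcs (G \<box> H)"
      if "u \<in> pverts (G \<box> H)" "v \<in> pverts (G \<box> H)" "u \<noteq> v" "(u, v) \<notin> parcs (G \<box> H)" for u v
      using that
      by (intro exI[of _ "(fst u, snd v)"]) (auto simp: verts arcs)
  qed
  also have "\<dots> \<longleftrightarrow> locating_array (pverts G) (pverts H) {1..k} (\<lambda>a b. c (a, b))"
  proof (cases "proper_coloring (G \<box> H) k c")
    case True
    have "c (a, b) = c (a', b') \<and>
          c ` (parcs (G \<box> H) `` {(a, b)}) = c ` (parcs (G \<box> H) `` {(a', b')}) \<longleftrightarrow>
          c (a, b) = c (a', b') \<and> ?seen a b = ?seen a' b'"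
      if "a \<in> pverts G" "b \<in> pverts H" "a' \<in> pverts G" "b' \<in> pverts H" for a b a' b'
      using own[OF that(1,2)] own[OF that(3,4)]
      unfolding nb[OF True that(1,2)] nb[OF True that(3,4)] by (metis insert_Diff)
    with True show ?thesis
      unfolding locating_array_def proper verts by simp
  next
    case False
    then show ?thesis unfolding locating_array_def using proper by blast
  qed
  finally show ?thesis .
qed

lemma locating_array_reindex:
  assumes f: "locating_array A B K f"
    and g: "bij_betw g A' A" and h: "bij_betw h B' B" and s: "bij_betw s K K'"
  shows "locating_array A' B' K' (\<lambda>a b. s (f (g a) (h b)))"
proof -
  have A: "A = g ` A'" and B: "B = h ` B'" and K: "K' = s ` K"
    using g h s by (auto simp: bij_betw_def)
  have K2: "K = (\<Union>a\<in>A. f a ` B)" using f by (auto simp: locating_array_def)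
  have inK: "f (g a) (h b) \<in> K" if "a \<in> A'" "b \<in> B'" for a b
    using that unfolding K2 A B by blast
  have gi: "g a = g a' \<longleftrightarrow> a = a'" if "a \<in> A'" "a' \<in> A'" for a a'
    using g that by (auto simp: bij_betw_def inj_on_def)
  have hi: "h a = h a' \<longleftrightarrow> a = a'" if "a \<in> B'" "a' \<in> B'" for a a'
    using h that by (auto simp: bij_betw_def inj_on_def)
  have si: "s a = s a' \<longleftrightarrow> a = a'" if "a \<in> K" "a' \<in> K" for a a'
    using s that by (auto simp: bij_betw_def inj_on_def)
  have seen: "seen A' B' (\<lambda>a b. s (f (g a) (h b))) a b = s ` seen A B f (g a) (h b)" for a b
    unfolding seen_def A B by (simp add: image_Un image_image)
  have seenK: "seen A B f (g a) (h b) \<subseteq> K" if "a \<in> A'" "b \<in> B'" for a b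
    using that unfolding seen_def K2 A B by blast
  show ?thesis
    unfolding locating_array_def
  proof (intro conjI ballI impI; (elim conjE)?)
    show "inj_on (\<lambda>b. s (f (g a) (h b))) B'" if "a \<in> A'" for a
    proof (rule inj_onI)
      fix x y assume "x \<in> B'" "y \<in> B'" "s (f (g a) (h x)) = s (f (g a) (h y))"
      moreover have "inj_on (f (g a)) B" using f that by (auto simp: locating_array_def A)
      ultimately show "x = y" using that by (auto simp: si inK B hi dest!: inj_onD)
    qed
    show "inj_on (\<lambda>a. s (f (g a) (h b))) A'" if "b \<in> B'" for b
    proof (rule inj_onI)
      fix x y assume "x \<in> A'" "y \<in> A'" "s (f (g x) (h b)) = s (f (g y) (h b))"
      moreover have "inj_on (\<lambda>a. f a (h b)) A" using f that by (auto simp: locating_array_def B)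
      ultimately show "x = y" using that by (auto simp: si inK A gi dest!: inj_onD)
    qed
    show "(\<Union>a\<in>A'. (\<lambda>b. s (f (g a) (h b))) ` B') = K'"
      unfolding K K2 A B by auto
    fix a b a' b' assume *: "a \<in> A'" "b \<in> B'" "a' \<in> A'" "b' \<in> B'"
      "s (f (g a) (h b)) = s (f (g a') (h b'))"
      "seen A' B' (\<lambda>a b. s (f (g a) (h b))) a b = seen A' B' (\<lambda>a b. s (f (g a) (h b))) a' b'"
    have "seen A B f (g a) (h b) = seen A B f (g a') (h b')"
      using * seenK s unfolding seen by (metis bij_betw_def inj_on_image_eq_iff)
    then have "g a = g a' \<and> h b = h b'"
      using f * unfolding locating_array_def by (auto simp: si inK A B)
    then show "a = a'" "b = b'" using * by (auto simp: gi hi)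
  qed
qed

lemma locating_arrayD:
  assumes "locating_array A B K f"
  shows "\<And>a. a \<in> A \<Longrightarrow> inj_on (f a) B"
    and "\<And>b. b \<in> B \<Longrightarrow> inj_on (\<lambda>a. f a b) A"
    and "(\<Union>a\<in>A. f a ` B) = K"
    and "\<And>a b a' b'. \<lbrakk>a \<in> A; b \<in> B; a' \<in> A; b' \<in> B; f a b = f a' b';
      seen A B f a b = seen A B f a' b'\<rbrakk> \<Longrightarrow> a = a' \<and> b = b'"
  using assms unfolding locating_array_def by blast+

text \<open>Cells in different rows are the only ones to compare: within a row, equal colors already
  force equal columns.\<close>

lemma locating_arrayI:
  assumes "\<And>a. a \<in> A \<Longrightarrow> inj_on (f a) B"
    and "\<And>b. b \<in> B \<Longrightarrow> inj_on (\<lambda>a. f a b) A"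
    and "(\<Union>a\<in>A. f a ` B) = K"
    and "\<And>a b a' b'. \<lbrakk>a \<in> A; b \<in> B; a' \<in> A; b' \<in> B; a \<noteq> a'; f a b = f a' b'\<rbrakk> \<Longrightarrow>
      seen A B f a b \<noteq> seen A B f a' b'"
  shows "locating_array A B K f"
  unfolding locating_array_def
proof (intro conjI ballI impI)
  fix a b a' b'
  assume *: "a \<in> A" "b \<in> B" "a' \<in> A" "b' \<in> B" "f a b = f a' b' \<and> seen A B f a b = seen A B f a' b'"
  then show "a = a'" using assms(4) by metis
  then show "b = b'" using * assms(1) by (metis inj_onD)
qed (use assms(1-3) in auto)

lemma seen_subset:
  assumes "locating_array A B K f" "a \<in> A" "b \<in> B"
  shows "seen A B f a b \<subseteq> K"
  using assms(2,3) unfolding seen_def locating_arrayD(3)[OF assms(1), symmetric] by blast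

section \<open>Lower bounds on the number of colors\<close>

text \<open>With at most \<open>card B\<close> colors each row shows all of \<open>K\<close>, so
  every cross equals \<open>K\<close>. Any color then occurs in two different rows, at cells that
  nothing separates.\<close>

lemma locating_array_card_less:
  assumes f: "locating_array A B K f" and "finite K" and "2 \<le> card A" and "0 < card B"
  shows "card B < card K"
proof (rule ccontr)
  assume "\<not> card B < card K"
  have row: "f a ` B = K" if "a \<in> A" for a
  proof (rule card_subset_eq[OF \<open>finite K\<close>])
    show sub: "f a ` B \<subseteq> K" using that locating_arrayD(3)[OF f] by blast
    have "card (f a ` B) = card B" using that f by (simp add: locating_arrayD(1) card_image)
    then show "card (f a ` B) = card K"
      using \<open>\<not> card B < card K\<close> card_mono[OF \<open>finite K\<close> sub] by simp
  qed
  obtain a a' where a: "a \<in> A" "a' \<in> A" "a \<noteq> a'"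
    using \<open>2 \<le> card A\<close> by (metis card_le_Suc0_iff_eq card.infinite not_less_eq_eq numeral_2_eq_2 zero_le)
  obtain b where b: "b \<in> B" using \<open>0 < card B\<close> by (metis card_gt_0_iff ex_in_conv)
  obtain b' where b': "b' \<in> B" "f a b = f a' b'"
    using row[OF a(1)] row[OF a(2)] b by blast
  have "seen A B f x y = K" if "x \<in> A" "y \<in> B" for x y
    using seen_subset[OF f that] row[OF that(1)] by (auto simp: seen_def)
  then show False using locating_arrayD(4)[OF f a(1) b a(2) b'] a b b'(1) by simp
qed

text \<open>Cells whose cross is all of \<open>K\<close> must have pairwise different colors, so
  there are at most \<open>card K\<close> of them. When different rows omit different colors, the
  color omitted by row \<open>a\<close> occurs in each other row, and each such occurrence makes the
  cell of row \<open>a\<close> in its column full; this yields \<open>card A - 1\<close> full cells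
  per row.\<close>

lemma locating_array_card_Suc:
  assumes f: "locating_array A B K f" and "finite A" "finite B" "finite K"
    and card: "card K = card B + 1" and small: "2 * card A < card B + 4"
  shows "card A * (card A - 1) \<le> card K"
proof -
  note inj = locating_arrayD(1)[OF f] and inj' = locating_arrayD(2)[OF f]
  have inK: "f a b \<in> K" if "a \<in> A" "b \<in> B" for a b
    using that locating_arrayD(3)[OF f] by blast
  have "\<exists>r. K - f a ` B = {r}" if "a \<in> A" for a
  proof -
    have "card (K - f a ` B) = 1"
      using that inK inj card \<open>finite B\<close> by (subst card_Diff_subset) (auto simp: card_image)
    then show ?thesis by (meson card_1_singletonE)
  qed
  then obtain r where r: "\<And>a. a \<in> A \<Longrightarrow> K - f a ` B = {r a}" by metis
  have rK: "r a \<in> K" if "a \<in> A" for a using r[OF that] by blast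
  have row: "f a ` B = K - {r a}" if "a \<in> A" for a using r[OF that] inK[OF that] by blast
  define col where "col b = (\<lambda>x. f x b) ` A" for b
  \<comment> \<open>The cells whose column supplies the one color that their row omits.\<close>
  define Full where "Full = {(a, b). a \<in> A \<and> b \<in> B \<and> r a \<in> col b}"
  have full: "seen A B f a b = K" if "(a, b) \<in> Full" for a b
    using that seen_subset[OF f, of a b] row[of a] unfolding Full_def seen_def col_def by auto
  have not_full: "seen A B f a b = K - {r a}" if "(a, b) \<notin> Full" "a \<in> A" "b \<in> B" for a b
    using that seen_subset[OF f, of a b] row[of a] unfolding Full_def seen_def col_def by auto
  have "Full \<subseteq> A \<times> B" by (auto simp: Full_def)
  then have "finite Full" using \<open>finite A\<close> \<open>finite B\<close> by (auto intro: finite_subset)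
  have "inj_on (\<lambda>(a, b). f a b) Full"
  proof (rule inj_onI, clarify)
    fix a b a' b' assume "(a, b) \<in> Full" "(a', b') \<in> Full" "f a b = f a' b'"
    then show "a = a' \<and> b = b'"
      using full[of a b] full[of a' b'] locating_arrayD(4)[OF f, of a b a' b'] by (simp add: Full_def)
  qed
  then have le: "card Full \<le> card K"
    using \<open>finite K\<close> inK by (intro card_inj_on_le) (auto simp: Full_def)
  \<comment> \<open>Suppose two rows omit the same color. Every other color occurs in both, and one
    of its two cells must be full, since otherwise both crosses would be \<open>K - {r a}\<close>.
    Hence the columns in \<open>C\<close>, those containing \<open>r a\<close>, account for all
    \<open>card B\<close> other colors, at most two per column.\<close>
  have rinj: "r a \<noteq> r a'" if a: "a \<in> A" "a' \<in> A" "a \<noteq> a'" for a a'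
  proof
    assume eq: "r a = r a'"
    define C where "C = {b \<in> B. r a \<in> col b}"
    have "finite C" using \<open>finite B\<close> by (simp add: C_def)
    have "K - {r a} \<subseteq> f a ` C \<union> f a' ` C"
    proof
      fix i assume i: "i \<in> K - {r a}"
      then obtain b b' where b: "b \<in> B" "b' \<in> B" "i = f a b" "i = f a' b'"
        using row[OF a(1)] row[OF a(2)] eq by (metis imageE)
      have "seen A B f a b \<noteq> seen A B f a' b'" using locating_arrayD(4)[OF f] a b by metis
      then have "(a, b) \<in> Full \<or> (a', b') \<in> Full"
        using not_full a b eq by metis
      then have "b \<in> C \<or> b' \<in> C" using eq by (auto simp: Full_def C_def)
      then show "i \<in> f a ` C \<union> f a' ` C" using b by blast
    qed
    then have "card (K - {r a}) \<le> card (f a ` C) + card (f a' ` C)"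
      using \<open>finite C\<close> by (meson card_Un_le card_mono finite_UnI finite_imageI order_trans)
    also have "\<dots> \<le> 2 * card C"
      using card_image_le[OF \<open>finite C\<close>, of "f a"] card_image_le[OF \<open>finite C\<close>, of "f a'"] by simp
    finally have B: "card B \<le> 2 * card C" using card rK[OF a(1)] \<open>finite K\<close> by simp
    \<comment> \<open>Each column of \<open>C\<close> has \<open>r a\<close> in some row other than
      \<open>a\<close> and \<open>a'\<close>, and no row contains \<open>r a\<close> twice. So
      \<open>card C \<le> card A - 2\<close>, whence \<open>card B \<le> 2 * (card A - 2)\<close>,
      against \<open>small\<close>.\<close>
    have "\<forall>b\<in>C. \<exists>x. x \<in> A \<and> f x b = r a" by (force simp: C_def col_def)
    then obtain w where w: "\<And>b. b \<in> C \<Longrightarrow> w b \<in> A \<and> f (w b) b = r a" by metis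
    have "w ` C \<subseteq> A - {a, a'}"
    proof
      fix x assume "x \<in> w ` C"
      then obtain b where "b \<in> C" "x = w b" by blast
      then show "x \<in> A - {a, a'}" using w[of b] row[OF a(1)] row[OF a(2)] eq by (auto simp: C_def)
    qed
    moreover have "inj_on w C"
      using w inj by (intro inj_onI) (metis (no_types, lifting) C_def inj_onD mem_Collect_eq)
    ultimately have "card C \<le> card (A - {a, a'})"
      using \<open>finite A\<close> by (intro card_inj_on_le) auto
    also have "\<dots> = card A - 2" using a \<open>finite A\<close> by (simp add: card_Diff_subset)
    finally have "card C \<le> card A - 2" .
    moreover have "2 \<le> card A" using a \<open>finite A\<close> card_mono[of A "{a, a'}"] by simp
    ultimately show False using B small by simp
  qed
  have "\<exists>b\<in>B. f a' b = r a" if "a \<in> A" "a' \<in> A - {a}" for a a'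
    using that row[of a'] rK[of a] rinj[of a a'] by (metis Diff_iff imageE singleton_iff)
  then obtain g where g: "\<And>a a'. a \<in> A \<Longrightarrow> a' \<in> A - {a} \<Longrightarrow> g a a' \<in> B \<and> f a' (g a a') = r a"
    by metis
  \<comment> \<open>The pair \<open>(a, a')\<close> is sent to the cell of row \<open>a\<close> in
    the column where row \<open>a'\<close> has the color \<open>r a\<close>. The map is injective
    because a column contains \<open>r a\<close> at most once.\<close>
  have "card (SIGMA a:A. A - {a}) \<le> card Full"
  proof (rule card_inj_on_le[OF _ _ \<open>finite Full\<close>])
    show "(\<lambda>(a, a'). (a, g a a')) ` (SIGMA a:A. A - {a}) \<subseteq> Full"
    proof (rule image_subsetI)
      fix p assume "p \<in> (SIGMA a:A. A - {a})"
      then obtain a a' where p: "p = (a, a')" "a \<in> A" "a' \<in> A - {a}" by blast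
      then show "(case p of (a, a') \<Rightarrow> (a, g a a')) \<in> Full"
        using g[of a a'] by (force simp: Full_def col_def)
    qed
    show "inj_on (\<lambda>(a, a'). (a, g a a')) (SIGMA a:A. A - {a})"
    proof (rule inj_onI)
      fix p q
      assume "p \<in> (SIGMA a:A. A - {a})" "q \<in> (SIGMA a:A. A - {a})"
        and "(case p of (a, a') \<Rightarrow> (a, g a a')) = (case q of (a, a') \<Rightarrow> (a, g a a'))"
      then obtain a a' a'' where pq: "p = (a, a')" "q = (a, a'')"
        and *: "a \<in> A" "a' \<in> A - {a}" "a'' \<in> A - {a}" "g a a' = g a a''"
        by auto
      then have "f a' (g a a') = f a'' (g a a')" "g a a' \<in> B" using g[of a a'] g[of a a''] by auto
      then show "p = q" using inj' * pq by (metis DiffD1 inj_onD)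
    qed
  qed
  moreover have "card (SIGMA a:A. A - {a}) = card A * (card A - 1)"
    using \<open>finite A\<close> by (subst card_SigmaI) auto
  ultimately show ?thesis using le by simp
qed

section \<open>An array with two more colors than columns\<close>

lemma rotation_bij:
  fixes N :: nat
  shows "bij_betw (\<lambda>b. (c + b) mod N) {..<N} {..<N}"
proof -
  have "inj_on (\<lambda>b. (c + b) mod N) {..<N}"
  proof (rule inj_onI)
    fix x y assume xy: "x \<in> {..<N}" "y \<in> {..<N}" "(c + x) mod N = (c + y) mod N"
    then have "[c + x = c + y] (mod N)" by (simp add: cong_def)
    then have "[x = y] (mod N)" by (simp add: cong_add_lcancel_nat)
    then show "x = y" using xy by (simp add: cong_def)
  qed
  moreover have "(\<lambda>b. (c + b) mod N) ` {..<N} \<subseteq> {..<N}" by (auto intro: mod_less_divisor)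
  ultimately show ?thesis by (simp add: bij_betw_def endo_inj_surj)
qed

text \<open>
  Row \<open>a\<close> omits exactly \<open>2 * a\<close> and \<open>2 * a + 1\<close>. By parity no column contains both, so every cell
  misses a color that distinguishes its row.
\<close>

lemma locating_array_rotations:
  fixes m N :: nat
  assumes "2 \<le> m" "2 * m \<le> N"
  shows "locating_array {..<m} {2..<N} {..<N} (\<lambda>a b. (2 * a + b) mod N)"
proof (rule locating_arrayI)
  let ?f = "\<lambda>a b::nat. (2 * a + b) mod N"
  have bij: "bij_betw (?f a) {..<N} {..<N}" for a by (rule rotation_bij)
  show "inj_on (?f a) {2..<N}" for a
    using bij[of a] by (auto simp: bij_betw_def intro: inj_on_subset)
  show "inj_on (\<lambda>a. ?f a b) {..<m}" for b
  proof (rule inj_onI)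
    fix x y assume xy: "x \<in> {..<m}" "y \<in> {..<m}" "?f x b = ?f y b"
    then have "[2 * x = 2 * y] (mod N)" by (simp add: cong_def[symmetric] cong_add_rcancel_nat)
    then show "x = y" using xy assms by (simp add: cong_def)
  qed
  \<comment> \<open>The columns 0 and 1 of the full rotation, which are left out, hold
    \<open>2 * a\<close> and \<open>2 * a + 1\<close>; both are below \<open>N\<close>, so no
    reduction takes place there.\<close>
  have row: "?f a ` {2..<N} = {..<N} - {2 * a, 2 * a + 1}" if "a < m" for a
  proof -
    have "{2..<N} = {..<N} - {0, 1}" by auto
    moreover have "?f a ` ({..<N} - {0, 1}) = ?f a ` {..<N} - ?f a ` {0, 1}"
      using bij[of a] assms by (intro inj_on_image_set_diff) (auto simp: bij_betw_def)
    moreover have "?f a ` {0, 1} = {2 * a, 2 * a + 1}" using that assms by simp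
    ultimately show ?thesis using bij[of a] by (simp add: bij_betw_def)
  qed
  show "(\<Union>a\<in>{..<m}. ?f a ` {2..<N}) = {..<N}"
  proof
    have in01: "0 \<in> {..<m}" "1 \<in> {..<m}" using assms(1) by auto
    show "{..<N} \<subseteq> (\<Union>a\<in>{..<m}. ?f a ` {2..<N})"
    proof
      fix i assume "i \<in> {..<N}"
      then have "i \<in> ({..<N} - {2 * 0, 2 * 0 + 1}) \<union> ({..<N} - {2 * 1, 2 * 1 + 1})" by auto
      also have "\<dots> = ?f 0 ` {2..<N} \<union> ?f 1 ` {2..<N}"
        using assms(1) by (subst (1 2) row) auto
      finally show "i \<in> (\<Union>a\<in>{..<m}. ?f a ` {2..<N})" using in01 by blast
    qed
  qed (use row in auto)
  fix a b a' b' assume *: "a \<in> {..<m}" "a' \<in> {..<m}" "a \<noteq> a'"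
  let ?seen = "seen {..<m} {2..<N} ?f"
  have "2 * a \<noteq> 2 * a' + 1" "2 * a + 1 \<noteq> 2 * a'" by presburger+
  then have "2 * a \<in> ?seen a' b'" "2 * a + 1 \<in> ?seen a' b'"
    using * row[of a'] assms unfolding seen_def by auto
  moreover have "2 * a \<notin> ?seen a b \<or> 2 * a + 1 \<notin> ?seen a b"
  proof (rule ccontr)
    assume "\<not> ?thesis"
    moreover have "2 * a \<notin> ?f a ` {2..<N}" "2 * a + 1 \<notin> ?f a ` {2..<N}" using row[of a] * by auto
    ultimately have "2 * a \<in> (\<lambda>x. ?f x b) ` {..<m}" "2 * a + 1 \<in> (\<lambda>x. ?f x b) ` {..<m}"
      unfolding seen_def by blast+
    then obtain x y where xy: "x < m" "y < m" "2 * a = ?f x b" "2 * a + 1 = ?f y b"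
      by blast
    \<comment> \<open>Cancelling \<open>b\<close> relates an odd and an even number modulo
      \<open>N\<close>. Both are below \<open>N\<close> because \<open>2 * m \<le> N\<close>, so
      they would be equal, whatever the parity of \<open>N\<close>.\<close>
    have "[2 * x + 1 + b = 2 * a + 1] (mod N)"
      using xy(3) by (metis cong_add_rcancel_nat cong_mod_left cong_refl add.assoc add.commute)
    also have "[2 * a + 1 = 2 * y + b] (mod N)"
      using xy(4) by simp
    finally have "[2 * x + 1 = 2 * y] (mod N)" by (simp only: cong_add_rcancel_nat)
    then have "2 * x + 1 = 2 * y" using xy assms by (simp add: cong_def)
    then show False by presburger
  qed
  ultimately show "?seen a b \<noteq> ?seen a' b'" by metis
qed

section \<open>Completion of partial Latin rectangles\<close>

text \<open>Among all bijections take one with the fewest forbidden pairs. If \<open>x\<close> has a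
  forbidden value, at most \<open>2 * d - 1\<close> elements, counting \<open>x\<close> itself, are
  ruled out as partners for exchanging values with \<open>x\<close>, so some exchange reduces the
  number of forbidden pairs.\<close>

lemma bij_betw_avoiding:
  assumes "finite X" "finite Y" "card X = card Y"
    and out: "\<And>x. x \<in> X \<Longrightarrow> card {y \<in> Y. F x y} \<le> d"
    and into: "\<And>y. y \<in> Y \<Longrightarrow> card {x \<in> X. F x y} \<le> d"
    and d: "2 * d \<le> card X"
  shows "\<exists>f. bij_betw f X Y \<and> (\<forall>x\<in>X. \<not> F x (f x))"
proof -
  have "\<exists>f. bij_betw f X Y" using assms(1-3) by (rule finite_same_card_bij)
  then obtain f where f: "bij_betw f X Y"
    and least: "\<And>g. bij_betw g X Y \<Longrightarrow> card {x \<in> X. F x (f x)} \<le> card {x \<in> X. F x (g x)}"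
    using ex_has_least_nat[of "\<lambda>f. bij_betw f X Y" _ "\<lambda>f. card {x \<in> X. F x (f x)}"] by metis
  have "\<not> F x (f x)" if x: "x \<in> X" for x
  proof
    assume F: "F x (f x)"
    have inj: "inj_on f X" and im: "f ` X = Y" using f by (auto simp: bij_betw_def)
    let ?S = "{y \<in> X. F x (f y)}" and ?T = "{y \<in> X. F y (f x)}"
    have "card ?S = card (f ` ?S)" using inj by (subst card_image) (auto intro: inj_on_subset)
    also have "f ` ?S = {y \<in> Y. F x y}" using im by auto
    finally have "card ?S \<le> d" using out[OF x] by simp
    moreover have "card ?T \<le> d" using x im by (intro into) auto
    \<comment> \<open>Both sets contain \<open>x\<close>; this overlap turns the bound
      \<open>2 * d\<close> into a strict inequality.\<close>
    moreover have "0 < card (?S \<inter> ?T)" using x F \<open>finite X\<close> by (subst card_gt_0_iff) auto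
    moreover have "card ?S + card ?T = card (?S \<union> ?T) + card (?S \<inter> ?T)"
      using \<open>finite X\<close> by (intro card_Un_Int) auto
    ultimately have "card (?S \<union> ?T) < card X" using d by linarith
    then have "\<not> X \<subseteq> ?S \<union> ?T"
      using \<open>finite X\<close> card_mono[of "?S \<union> ?T" X] by (auto simp: not_le)
    then obtain y where y: "y \<in> X" "\<not> F x (f y)" "\<not> F y (f x)" by blast
    \<comment> \<open>swapping the values at \<open>x\<close> and \<open>y\<close> repairs \<open>x\<close> and does no harm at \<open>y\<close>\<close>
    define g where "g = f(x := f y, y := f x)"
    have "x \<noteq> y" using F y by blast
    have "inj_on g X"
      using inj x y(1) unfolding g_def inj_on_def by auto
    moreover have "g ` X = Y"
      using x y(1) im unfolding g_def by (force simp: image_iff)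
    ultimately have "bij_betw g X Y" by (simp add: bij_betw_def)
    moreover have "{z \<in> X. F z (g z)} \<subset> {z \<in> X. F z (f z)}"
      using x F y \<open>x \<noteq> y\<close> by (auto simp: g_def)
    then have "card {z \<in> X. F z (g z)} < card {z \<in> X. F z (f z)}"
      using \<open>finite X\<close> by (intro psubset_card_mono) auto
    ultimately show False using least by fastforce
  qed
  then show ?thesis using f by blast
qed

text \<open>The rows are completed one at a time. In the current row at least \<open>N - e\<close>
  columns are free, and each free column or color conflicts with at most one entry of each of the
  \<open>m - 1\<close> other rows, so \<open>bij_betw_avoiding\<close> applies with
  \<open>d = m - 1\<close>.\<close>

lemma latin_rectangle_completion:
  fixes D :: "nat \<Rightarrow> nat set" and P :: "nat \<Rightarrow> nat \<Rightarrow> nat"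
  assumes D: "\<And>a. a < m \<Longrightarrow> D a \<subseteq> {..<N}" "\<And>a. a < m \<Longrightarrow> card (D a) \<le> e"
    and P: "\<And>a. a < m \<Longrightarrow> inj_on (P a) (D a)" "\<And>a. a < m \<Longrightarrow> P a ` D a \<subseteq> {..<N}"
    and col: "\<And>a a' b. \<lbrakk>a < m; a' < m; a \<noteq> a'; b \<in> D a; b \<in> D a'\<rbrakk> \<Longrightarrow> P a b \<noteq> P a' b"
    and N: "e + 2 * (m - 1) \<le> N"
  shows "\<exists>L. (\<forall>a<m. bij_betw (L a) {..<N} {..<N} \<and> (\<forall>b\<in>D a. L a b = P a b)) \<and>
    (\<forall>b<N. inj_on (\<lambda>a. L a b) {..<m})"
proof -
  \<comment> \<open>The columns in which row \<open>a\<close> is settled once the first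
    \<open>k\<close> rows are complete. Values of \<open>L a\<close> outside \<open>E k a\<close>
    are arbitrary.\<close>
  define E where "E k a = (if a < k then {..<N} else D a)" for k a :: nat
  define partial where "partial k L \<longleftrightarrow>
    (\<forall>a<m. inj_on (L a) (E k a) \<and> L a ` E k a \<subseteq> {..<N} \<and> (\<forall>b\<in>D a. L a b = P a b)) \<and>
    (\<forall>a<m. \<forall>a'<m. a \<noteq> a' \<longrightarrow> (\<forall>b\<in>E k a \<inter> E k a'. L a b \<noteq> L a' b))" for k L
  have "\<exists>L. partial k L" if "k \<le> m" for k
    using that
  proof (induction k)
    case 0
    have "partial 0 P" using P col by (simp add: partial_def E_def)
    then show ?case by blast
  next
    case (Suc k)
    then have "k < m" by simp
    from Suc obtain L where L: "partial k L" by auto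
    have Linj: "inj_on (L a) (E k a)" and Lim: "L a ` E k a \<subseteq> {..<N}"
      and LP: "\<And>b. b \<in> D a \<Longrightarrow> L a b = P a b" if "a < m" for a
      using L that by (auto simp: partial_def)
    have Lcol: "L a b \<noteq> L a' b" if "a < m" "a' < m" "a \<noteq> a'" "b \<in> E k a" "b \<in> E k a'" for a a' b
      using L that by (auto simp: partial_def)
    have Ek: "E k k = D k" by (simp add: E_def)
    define X where "X = {..<N} - D k"
    define Y where "Y = {..<N} - L k ` D k"
    \<comment> \<open>Entries prescribed in rows still to be completed count as conflicts too, so
      that later rows keep their prescribed values.\<close>
    define F where "F x y \<longleftrightarrow> (\<exists>a\<in>{..<m} - {k}. x \<in> E k a \<and> L a x = y)" for x y
    have Dk: "D k \<subseteq> {..<N}" "finite (D k)" using D(1)[OF \<open>k < m\<close>] finite_subset by auto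
    have LD: "L k ` D k \<subseteq> {..<N}" "inj_on (L k) (D k)"
      using Lim[OF \<open>k < m\<close>] Linj[OF \<open>k < m\<close>] Ek by auto
    have cX: "card X = N - card (D k)" using Dk by (simp add: X_def card_Diff_subset)
    have cY: "card Y = N - card (D k)"
      using Dk LD by (simp add: Y_def card_Diff_subset card_image)
    have others: "card ({..<m} - {k}) = m - 1" using \<open>k < m\<close> by simp
    have "\<exists>f. bij_betw f X Y \<and> (\<forall>x\<in>X. \<not> F x (f x))"
    proof (rule bij_betw_avoiding)
      show "finite X" "finite Y" by (auto simp: X_def Y_def)
      show "card X = card Y" using cX cY by simp
      show "2 * (m - 1) \<le> card X" using cX D(2)[OF \<open>k < m\<close>] N by simp
      show "card {y \<in> Y. F x y} \<le> m - 1" for x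
      proof -
        have "{y \<in> Y. F x y} \<subseteq> (\<lambda>a. L a x) ` ({..<m} - {k})" by (auto simp: F_def)
        then have "card {y \<in> Y. F x y} \<le> card ({..<m} - {k})" by (simp add: surj_card_le)
        then show ?thesis using others by simp
      qed
      show "card {x \<in> X. F x y} \<le> m - 1" for y
      proof -
        \<comment> \<open>A settled row contains the color \<open>y\<close> at most once, so it
          blocks \<open>y\<close> in at most one column, recovered by
          \<open>inv_into\<close>.\<close>
        have "{x \<in> X. F x y} \<subseteq> (\<lambda>a. inv_into (E k a) (L a) y) ` ({..<m} - {k})"
        proof
          fix x assume "x \<in> {x \<in> X. F x y}"
          then obtain a where a: "a \<in> {..<m} - {k}" "x \<in> E k a" "L a x = y" by (auto simp: F_def)
          then have "x = inv_into (E k a) (L a) y" using Linj[of a] by (auto simp: inv_into_f_f)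
          then show "x \<in> (\<lambda>a. inv_into (E k a) (L a) y) ` ({..<m} - {k})" using a(1) by blast
        qed
        then have "card {x \<in> X. F x y} \<le> card ({..<m} - {k})" by (simp add: surj_card_le)
        then show ?thesis using others by simp
      qed
    qed
    then obtain f where f: "bij_betw f X Y" and avoid: "\<And>x. x \<in> X \<Longrightarrow> \<not> F x (f x)" by blast
    define h where "h b = (if b \<in> D k then L k b else f b)" for b
    have "bij_betw h (D k \<union> X) (L k ` D k \<union> Y)"
    proof (rule bij_betw_combine)
      have "bij_betw (L k) (D k) (L k ` D k)" using LD by (simp add: bij_betw_def)
      then show "bij_betw h (D k) (L k ` D k)"
        by (rule bij_betw_cong[THEN iffD1, rotated]) (simp add: h_def)
      show "bij_betw h X Y"
        using f by (rule bij_betw_cong[THEN iffD1, rotated]) (simp add: h_def X_def)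
    qed (auto simp: Y_def)
    moreover have "D k \<union> X = {..<N}" "L k ` D k \<union> Y = {..<N}" using Dk LD by (auto simp: X_def Y_def)
    ultimately have h: "bij_betw h {..<N} {..<N}" by simp
    have hcol: "h b \<noteq> L a b" if "a < m" "a \<noteq> k" "b \<in> E k a" "b < N" for a b
    proof (cases "b \<in> D k")
      case True
      then show ?thesis using Lcol[of a k b] that \<open>k < m\<close> Ek by (auto simp: h_def)
    next
      case False
      then have "\<not> F b (f b)" using avoid that by (simp add: X_def)
      then show ?thesis using that False by (auto simp: F_def h_def)
    qed
    have EN: "E k a \<subseteq> {..<N}" if "a < m" for a using D(1)[OF that] by (auto simp: E_def)
    have E': "E (Suc k) a = (if a = k then {..<N} else E k a)" for a by (auto simp: E_def)
    have "partial (Suc k) (L(k := h))"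
      unfolding partial_def
    proof (intro conjI allI impI ballI)
      fix a assume a: "a < m"
      show "inj_on ((L(k := h)) a) (E (Suc k) a)"
        using h Linj[OF a] by (simp add: E' bij_betw_def)
      show "(L(k := h)) a ` E (Suc k) a \<subseteq> {..<N}"
        using h Lim[OF a] by (simp add: E' bij_betw_def)
      show "(L(k := h)) a b = P a b" if "b \<in> D a" for b
        using LP[OF a that] that by (auto simp: h_def)
      fix a' b assume "a' < m" "a \<noteq> a'" "b \<in> E (Suc k) a \<inter> E (Suc k) a'"
      then show "(L(k := h)) a b \<noteq> (L(k := h)) a' b"
        using a Lcol[of a a' b] hcol[of a b] hcol[of a' b] EN[of a] EN[of a']
        by (auto simp: E' split: if_splits)
    qed
    then show ?case by blast
  qed
  then obtain L where L: "partial m L" by blast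
  have "bij_betw (L a) {..<N} {..<N} \<and> (\<forall>b\<in>D a. L a b = P a b)" if "a < m" for a
  proof -
    have "inj_on (L a) {..<N}" "L a ` {..<N} \<subseteq> {..<N}" "\<forall>b\<in>D a. L a b = P a b"
      using L that by (simp_all add: partial_def E_def)
    then show ?thesis by (simp add: bij_betw_def endo_inj_surj)
  qed
  moreover have "inj_on (\<lambda>a. L a b) {..<m}" if "b < N" for b
  proof (rule inj_onI)
    fix a a' assume "a \<in> {..<m}" "a' \<in> {..<m}" "L a b = L a' b"
    moreover have "\<forall>a<m. \<forall>a'<m. a \<noteq> a' \<longrightarrow> (\<forall>b\<in>E m a \<inter> E m a'. L a b \<noteq> L a' b)"
      using L by (simp add: partial_def)
    ultimately show "a = a'" using that by (auto simp: E_def)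
  qed
  ultimately show ?thesis by blast
qed

section \<open>An array with one more color than columns\<close>

text \<open>Without column 0, row \<open>a\<close> omits exactly the color \<open>a\<close>. If
  cells of rows \<open>a\<close> and \<open>a'\<close> have equal crosses, then \<open>a\<close>,
  which row \<open>a'\<close> shows, must come from the column of the first cell, and
  \<open>full\<close> makes the color of that cell its column number. The same holds for the second
  cell, so equal colors would put both cells into one column.\<close>

lemma locating_array_delete_column:
  fixes L :: "nat \<Rightarrow> nat \<Rightarrow> nat"
  assumes "2 \<le> m" "m \<le> N"
    and L: "\<And>a. a < m \<Longrightarrow> bij_betw (L a) {..<N} {..<N}"
    and col: "\<And>b. b < N \<Longrightarrow> inj_on (\<lambda>a. L a b) {..<m}"
    and L0: "\<And>a. a < m \<Longrightarrow> L a 0 = a"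
    and full: "\<And>a x b. \<lbrakk>a < m; x < m; a \<noteq> x; b < N; L x b = a\<rbrakk> \<Longrightarrow> L a b = b"
  shows "locating_array {..<m} {1..<N} {..<N} L"
proof (rule locating_arrayI)
  have row: "L a ` {1..<N} = {..<N} - {a}" if "a < m" for a
  proof -
    have "{1..<N} = {..<N} - {0}" by auto
    moreover have "L a ` ({..<N} - {0}) = L a ` {..<N} - L a ` {0}"
      using L[OF that] assms(1,2) by (intro inj_on_image_set_diff) (auto simp: bij_betw_def)
    ultimately show ?thesis using L[OF that] L0[OF that] by (simp add: bij_betw_def)
  qed
  show "inj_on (L a) {1..<N}" if "a \<in> {..<m}" for a
    using L[of a] that by (auto simp: bij_betw_def intro: inj_on_subset)
  show "inj_on (\<lambda>a. L a b) {..<m}" if "b \<in> {1..<N}" for b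
    using col that by simp
  show "(\<Union>a\<in>{..<m}. L a ` {1..<N}) = {..<N}"
  proof
    have in01: "0 \<in> {..<m}" "1 \<in> {..<m}" using assms(1) by auto
    show "{..<N} \<subseteq> (\<Union>a\<in>{..<m}. L a ` {1..<N})"
    proof
      fix i assume "i \<in> {..<N}"
      then have "i \<in> ({..<N} - {0}) \<union> ({..<N} - {1})" by auto
      also have "\<dots> = L 0 ` {1..<N} \<union> L 1 ` {1..<N}" using assms(1) row by simp
      finally show "i \<in> (\<Union>a\<in>{..<m}. L a ` {1..<N})" using in01 by blast
    qed
  qed (use row in auto)
  fix a b a' b' assume *: "a \<in> {..<m}" "b \<in> {1..<N}" "a' \<in> {..<m}" "b' \<in> {1..<N}" "a \<noteq> a'"
    and eq: "L a b = L a' b'"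
  let ?seen = "seen {..<m} {1..<N} L"
  have fixed: "L u v = v"
    if u: "u < m" "v \<in> {1..<N}" "u' < m" "u \<noteq> u'" and seen: "?seen u v = ?seen u' v'" for u v u' v'
  proof -
    have "u \<in> ?seen u' v'" using row[OF u(3)] u assms(2) unfolding seen_def by auto
    then have "u \<in> ?seen u v" using seen by simp
    moreover have "u \<notin> L u ` {1..<N}" using row[OF u(1)] by auto
    ultimately obtain x where x: "x < m" "L x v = u" unfolding seen_def by auto
    moreover have "x \<noteq> u" using x(2) u(2) \<open>u \<notin> L u ` {1..<N}\<close> by (metis imageI)
    ultimately show "L u v = v" using full[of u x v] u by simp
  qed
  show "?seen a b \<noteq> ?seen a' b'"
  proof
    assume "?seen a b = ?seen a' b'"
    then have "L a b = b" "L a' b' = b'" using fixed[of a b a' b'] fixed[of a' b' a b] * by auto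
    then have "L a b = L a' b" using eq by simp
    then show False using col[of b] * by (auto dest: inj_onD)
  qed
qed

text \<open>
  In the prescribed part, column \<open>0\<close> is the one to be deleted. The color \<open>a\<close> omitted by row \<open>a\<close>
  occurs in row \<open>x\<close> in column \<open>Suc a * m + x\<close>, where row \<open>a\<close> has a color used for
  the pair \<open>(a, x)\<close> only, namely the column number.
\<close>

lemma ex_locating_array_Suc:
  fixes m N :: nat
  assumes m: "2 \<le> m" and N: "m * (m + 1) \<le> N"
  shows "\<exists>L. locating_array {..<m} {1..<N} {..<N} L"
proof -
  \<comment> \<open>After column 0, the columns from \<open>m\<close> on form \<open>m\<close>
    blocks of length \<open>m\<close>, and column \<open>Suc c * m + j\<close> serves the pair
    \<open>(c, j)\<close>. It is prescribed in rows \<open>c\<close> and \<open>j\<close> only. The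
    offset by one block keeps column numbers used as colors apart from the omitted colors, which are
    below \<open>m\<close>.\<close>
  define D where "D a = insert 0 {Suc c * m + j | c j. c < m \<and> j < m \<and> (c = a \<or> j = a)}" for a
  \<comment> \<open>In the column of \<open>(c, j)\<close>, row \<open>c\<close> receives the column
    number and any other row the color \<open>c\<close>, read off as
    \<open>b div m - 1\<close>.\<close>
  define P where "P a b = (if b = 0 then a else if b div m = Suc a then b else b div m - 1)" for a b
  have P0: "P a 0 = a" for a by (simp add: P_def)
  have P1: "P a (Suc c * m + j) = (if c = a then Suc c * m + j else c)" if "j < m" for a c j
  proof -
    have "(Suc c * m + j) div m = Suc c" using that by (metis add.commute add_0 div_less div_mult_self3 less_zeroE)
    then show ?thesis using that m by (simp add: P_def del: mult_Suc)
  qed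
  have bound: "Suc c * m + j < N" if "c < m" "j < m" for c j
  proof -
    have "Suc c * m + j < Suc (Suc c) * m" using that by simp
    also have "\<dots> \<le> (m + 1) * m" using that by (intro mult_right_mono) auto
    finally show ?thesis using N by (simp add: mult.commute)
  qed
  have big: "m \<le> Suc c * m + j" for c j by simp
  have unique: "c = c' \<and> j = j'" if "Suc c * m + j = Suc c' * m + j'" "j < m" "j' < m" for c j c' j'
  proof -
    \<comment> \<open>The row index \<open>Suc c + c'\<close> differs from both \<open>c\<close> and
      \<open>c'\<close>, so \<open>P\<close> returns the block number in either column.\<close>
    have "P (Suc c + c') (Suc c * m + j) = P (Suc c + c') (Suc c' * m + j')"
      using that(1) by (rule arg_cong)
    then have "c = c'" unfolding P1[OF that(2)] P1[OF that(3)] by simp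
    then show ?thesis using that(1) by simp
  qed
  have cells: thesis
    if "b \<in> D a" "b = 0 \<Longrightarrow> thesis"
      "\<And>c j. \<lbrakk>b = Suc c * m + j; c < m; j < m; c = a \<or> j = a\<rbrakk> \<Longrightarrow> thesis" for a b thesis
    using that unfolding D_def by blast
  have "\<exists>L. (\<forall>a<m. bij_betw (L a) {..<N} {..<N} \<and> (\<forall>b\<in>D a. L a b = P a b)) \<and>
    (\<forall>b<N. inj_on (\<lambda>a. L a b) {..<m})"
  proof (rule latin_rectangle_completion)
    \<comment> \<open>Writing \<open>m = k + 2\<close> removes the truncated subtraction; the two
      sides then differ by \<open>k * (k + 1)\<close>.\<close>
    obtain k where k: "m = k + 2" using m by (metis le_Suc_ex add.commute)
    have "2 * m + 2 * (m - 1) \<le> m * (m + 1)" unfolding k by (simp add: algebra_simps)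
    then show "2 * m + 2 * (m - 1) \<le> N" using N by linarith
    have "0 < N" using bound[of 0 0] m by simp
    fix a assume a: "a < m"
    show "D a \<subseteq> {..<N}" using bound \<open>0 < N\<close> unfolding D_def by auto
    let ?row = "(\<lambda>j. Suc a * m + j) ` {..<m}" and ?col = "(\<lambda>c. Suc c * m + a) ` ({..<m} - {a})"
    have "D a \<subseteq> insert 0 (?row \<union> ?col)" by (auto simp: D_def)
    then have "card (D a) \<le> card (insert 0 (?row \<union> ?col))" by (intro card_mono) auto
    also have "\<dots> \<le> Suc (card (?row \<union> ?col))" by (simp add: card_insert_if)
    also have "\<dots> \<le> Suc (card ?row + card ?col)" using card_Un_le by (rule Suc_le_mono[THEN iffD2])
    also have "\<dots> \<le> Suc (m + (m - 1))"
      using a card_image_le[of "{..<m}" "\<lambda>j. Suc a * m + j"]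
        card_image_le[of "{..<m} - {a}" "\<lambda>c. Suc c * m + a"] by simp
    finally show "card (D a) \<le> 2 * m" using m by simp
    \<comment> \<open>Three kinds of prescribed entries: the color \<open>a\<close> in column 0,
      column numbers of size at least \<open>m\<close>, and small colors other than
      \<open>a\<close>. The kinds have disjoint values, and within each kind the value determines
      the column.\<close>
    have val: "(b = 0 \<and> P a b = a) \<or> (P a b = b \<and> m \<le> b) \<or> (P a b < m \<and> P a b \<noteq> a \<and> b = Suc (P a b) * m + a)"
      if "b \<in> D a" for b
      using that by (rule cells) (use P0 P1 big in \<open>auto simp del: mult_Suc\<close>)
    show "inj_on (P a) (D a)"
    proof (rule inj_onI)
      fix x y assume "x \<in> D a" "y \<in> D a" "P a x = P a y"
      then show "x = y" using val[of x] val[of y] a by (metis leD)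
    qed
    have "m \<le> N" using bound[of 0 0] m by simp
    show "P a ` D a \<subseteq> {..<N}"
      using val \<open>D a \<subseteq> {..<N}\<close> a \<open>m \<le> N\<close> by fastforce
    fix a' b assume a': "a' < m" "a \<noteq> a'" "b \<in> D a" "b \<in> D a'"
    from a'(3) show "P a b \<noteq> P a' b"
    proof (rule cells)
      fix c j assume b: "b = Suc c * m + j" "c < m" "j < m" "c = a \<or> j = a"
      obtain c' j' where b': "b = Suc c' * m + j'" "j' < m" "c' = a' \<or> j' = a'"
        using a'(4) b m by (auto elim!: cells simp del: mult_Suc)
      \<comment> \<open>So the rows \<open>a\<close> and \<open>a'\<close> are \<open>c\<close> and
        \<open>j\<close> in some order: one has the column number, which is at least
        \<open>m\<close>, and the other has \<open>c < m\<close>.\<close>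
      then have "c = a' \<or> j = a'" using unique[of c j c' j'] b by auto
      then show ?thesis
        using b a'(2) P1[OF b(3), of a c] P1[OF b(3), of a' c] big[of c j] by (auto simp del: mult_Suc)
    qed (use a'(2) P0 in auto)
  qed
  then obtain L where L: "\<And>a. a < m \<Longrightarrow> bij_betw (L a) {..<N} {..<N}"
    and LP: "\<And>a b. \<lbrakk>a < m; b \<in> D a\<rbrakk> \<Longrightarrow> L a b = P a b"
    and col: "\<And>b. b < N \<Longrightarrow> inj_on (\<lambda>a. L a b) {..<m}" by metis
  have "locating_array {..<m} {1..<N} {..<N} L"
  proof (rule locating_array_delete_column[OF m _ L col])
    show "m \<le> N" using bound[of 0 0] m by simp
    show "L a 0 = a" if "a < m" for a using that LP P0 by (simp add: D_def)
    show "L a b = b" if *: "a < m" "x < m" "a \<noteq> x" "b < N" "L x b = a" for a x b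
    proof -
      let ?b = "Suc a * m + x"
      have D: "?b \<in> D x" "?b \<in> D a" using * unfolding D_def by blast+
      \<comment> \<open>Row \<open>x\<close> contains the color \<open>a\<close> only once, so
        \<open>b\<close> is the prescribed column \<open>?b\<close>, where row \<open>a\<close>
        holds its column number.\<close>
      have "L x ?b = a" using LP[OF *(2) D(1)] P1[OF *(2), of x a] * by simp
      then have "b = ?b"
        using L[OF *(2)] *(4,5) bound[OF *(1,2)] unfolding bij_betw_def by (metis inj_onD lessThan_iff)
      then show "L a b = b" using LP[OF *(1) D(2)] P1[OF *(2), of a a] by simp
    qed
  qed
  then show ?thesis by blast
qed

section \<open>From arrays to the locating chromatic number\<close>

lemma ex_locating_coloring_complete_product:
  assumes "K\<^bsub>m\<^esub> (with_proj G)" and "K\<^bsub>n\<^esub> (with_proj H)"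
    and f: "locating_array A B K f" and fin: "finite A" "finite B" "finite K"
    and card: "card A = m" "card B = n" "card K = k"
  shows "\<exists>c. locating_coloring (G \<box> H) k c"
proof -
  have G: "finite (pverts G)" "card (pverts G) = m" and H: "finite (pverts H)" "card (pverts H) = n"
    using assms(1,2) by (simp_all add: complete_digraph_pair_def)
  obtain g h s where "bij_betw g (pverts G) A" "bij_betw h (pverts H) B" "bij_betw s K {1..k}"
    using finite_same_card_bij[OF G(1) fin(1)] finite_same_card_bij[OF H(1) fin(2)]
      finite_same_card_bij[OF fin(3), of "{1..k}"] G H card by auto
  then have "locating_array (pverts G) (pverts H) {1..k} (\<lambda>a b. s (f (g a) (h b)))"
    by (rule locating_array_reindex[OF f])
  then have "locating_coloring (G \<box> H) k (\<lambda>(a, b). s (f (g a) (h b)))"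
    by (simp add: locating_coloring_complete_product_iff[OF assms(1,2)])
  then show ?thesis by blast
qed

text \<open>The integer inequality agrees with its natural-number form, the truncated case
  \<open>k = 0\<close> satisfying both. The set is finite because
  \<open>k - 1 \<le> k * (k - 1)\<close> for \<open>k > 1\<close>, so the maximum is
  attained.\<close>

lemma Max_quadratic:
  fixes n :: nat
  defines "S \<equiv> {k :: nat. int k * (int k - 1) - 1 \<le> int n}"
  shows "Max S * (Max S - 1) \<le> n + 1" and "\<And>k. k * (k - 1) \<le> n + 1 \<Longrightarrow> k \<le> Max S"
proof -
  have S: "k \<in> S \<longleftrightarrow> k * (k - 1) \<le> n + 1" for k
  proof (cases k)
    case (Suc j)
    then have j: "int k - 1 = int j" by simp
    have "k \<in> S \<longleftrightarrow> int (k * j) \<le> int (n + 1)"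
      unfolding S_def mem_Collect_eq j by (simp only: diff_le_eq of_nat_mult of_nat_add of_nat_1)
    then show ?thesis unfolding of_nat_le_iff by (simp add: Suc)
  qed (simp add: S_def)
  have "k \<le> n + 2" if "k \<in> S" for k
  proof (cases "k \<le> 1")
    case False
    then have "k - 1 \<le> k * (k - 1)" by simp
    then show ?thesis using that S[of k] by linarith
  qed auto
  then have fin: "finite S" using finite_subset[of S "{..n + 2}"] by auto
  have "0 \<in> S" using S[of 0] by simp
  then have "Max S \<in> S" using Max_in[OF fin] by blast
  then show "Max S * (Max S - 1) \<le> n + 1" using S by simp
  show "k \<le> Max S" if "k * (k - 1) \<le> n + 1" for k
    using Max_ge[OF fin] S that by simp
qed

theorem theorem3:
  fixes G :: "'a pair_pre_digraph" and H :: "'b pair_pre_digraph" and m n m\<^sub>0 :: nat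
  assumes "m \<ge> 2" and "n \<ge> 3" and "m \<le> n"
    and "K\<^bsub>m\<^esub> (with_proj G)" and "K\<^bsub>n\<^esub> (with_proj H)"
    and "m\<^sub>0 = Max {k :: nat. int k * (int k - 1) - 1 \<le> int n}"
  shows "(m \<le> m\<^sub>0 - 1 \<longrightarrow> \<chi>\<^sub>L (G \<box> H) = n + 1) \<and>
         (m\<^sub>0 + 1 \<le> m \<and> real m \<le> real n / 2 \<longrightarrow> \<chi>\<^sub>L (G \<box> H) = n + 2)"
proof -
  note complete = \<open>K\<^bsub>m\<^esub> (with_proj G)\<close> \<open>K\<^bsub>n\<^esub> (with_proj H)\<close>
  note iff = locating_coloring_complete_product_iff[OF complete]
  have G: "finite (pverts G)" "card (pverts G) = m" and H: "finite (pverts H)" "card (pverts H) = n"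
    using complete by (simp_all add: complete_digraph_pair_def)
  have gt: "n < k" if "locating_coloring (G \<box> H) k c" for k c
    using that locating_array_card_less[of "pverts G" "pverts H" "{1..k}" "\<lambda>a b. c (a, b)"] G H assms(1,2)
    by (simp add: iff)
  show ?thesis
  proof (intro conjI impI)
    assume "m \<le> m\<^sub>0 - 1"
    \<comment> \<open>Truncation in \<open>m\<^sub>0 - 1\<close> is harmless because
      \<open>m\<close> is positive.\<close>
    then have "m + 1 \<le> m\<^sub>0" using assms(1) by linarith
    then have "(m + 1) * m \<le> m\<^sub>0 * (m\<^sub>0 - 1)" by (intro mult_mono) auto
    also have "\<dots> \<le> n + 1" unfolding assms(6) by (rule Max_quadratic)
    finally obtain L where "locating_array {..<m} {1..<n + 1} {..<n + 1} L"
      using ex_locating_array_Suc[OF assms(1), of "n + 1"] by (auto simp: mult.commute)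
    then have "\<exists>c. locating_coloring (G \<box> H) (n + 1) c"
      by (rule ex_locating_coloring_complete_product[OF complete]) auto
    then show "\<chi>\<^sub>L (G \<box> H) = n + 1"
      unfolding locating_chromatic_number_def by (rule Least_equality) (use gt in force)
  next
    assume m: "m\<^sub>0 + 1 \<le> m \<and> real m \<le> real n / 2"
    then have mn: "2 * m \<le> n" by linarith
    \<comment> \<open>By maximality of \<open>m\<^sub>0\<close>. This contradicts the count of full
      cells, and \<open>2 * m \<le> n\<close> provides the smallness that the count requires, so
      \<open>n + 1\<close> colors are excluded.\<close>
    have "\<not> m * (m - 1) \<le> n + 1"
      using Max_quadratic(2)[of m n] m unfolding assms(6) by linarith
    then have ne: "k \<noteq> n + 1" if "locating_coloring (G \<box> H) k c" for k c
      using that locating_array_card_Suc[of "pverts G" "pverts H" "{1..k}" "\<lambda>a b. c (a, b)"] G H mn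
      by (auto simp: iff)
    have "locating_array {..<m} {2..<n + 2} {..<n + 2} (\<lambda>a b. (2 * a + b) mod (n + 2))"
      using assms(1) mn by (intro locating_array_rotations) auto
    then have "\<exists>c. locating_coloring (G \<box> H) (n + 2) c"
      by (rule ex_locating_coloring_complete_product[OF complete]) auto
    moreover have "n + 2 \<le> k" if "locating_coloring (G \<box> H) k c" for k c
      using gt[OF that] ne[OF that] by linarith
    ultimately show "\<chi>\<^sub>L (G \<box> H) = n + 2"
      unfolding locating_chromatic_number_def by (intro Least_equality) auto
  qed
qed

end
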